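(* Let $t_1,\ldots,t_n\in\mathbb{R}^d$ be fixed. 1. The mapping $\Psi: S\to\mathbb{R}^{\mathbb{R}^d}$, $(x,y,f)\mapsto y f(\cdot-x)$, is $(\mathcal{B}^d\times(\mathcal{B}\cap(0,\infty))\times 2^G,\ \mathcal{C})$-measurable. 2. Let $A\in\mathcal{A}$ and let $B\subset S$ be a bounded Borel set. Then $|\Pi\cap I_A(Z(\mathbf{t}))\cap B|$ is a random variable. 3. $\Pi_1$, $\Pi_2$ and $\Pi_3$ are point processes.
   Context: Let $G$ be a countable set of measurable functions $f:\mathbb{R}^d\to[0,\infty)$, with $\sigma$-algebra $2^G$, and let $F$ be a $G$-valued random function with law $\mathbb{P}_F$ such that $\mathbb{E}\left(\int_{\mathbb{R}^d}F(x)\,\mathrm{d}x\right)=1$. Let $S=\mathbb{R}^d\times(0,\infty)\times G$, and let $\Pi$ be a Poisson point process on $S$ with intensity measure $\Lambda(A\times B\times C)=\mu(A)\,\mathbb{P}_F(C)\int_B u^{-2}\,\mathrm{d}u$ for $A\in\mathcal{B}^d$, $B\in\mathcal{B}\cap(0,\infty)$, $C\in 2^G$, where $\mu$ is Lebesgue measure and $\mathcal{B}^d$, $\mathcal{B}$ are the Borel $\sigma$-algebras of $\mathbb{R}^d$, $\mathbb{R}$. Define $Z(t)=\max_{(s,u,f)\in\Pi}u f(t-s)$, $t\in\mathbb{R}^d$. For $\mathbf{t}=(t_1,\ldots,t_n)$ write $Z(\mathbf{t})=(Z(t_1),\ldots,Z(t_n))$; for $\mathbf{z}=(z_1,\ldots,z_n)\in(0,\infty)^n$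 (convention $z/0=\infty$ for $z>0$) let $K_{\mathbf{t},\mathbf{z}}=\{(x,y,f)\in S: y=\min_{i=1,\ldots,n} z_i/f(t_i-x)\}$ and $\overline{K_{\mathbf{t},\mathbf{z}}}=\{(x,y,f)\in S: y f(t_j-x)>z_j\text{ for some }j\in\{1,\ldots,n\}\}$. Let $\mathcal{A}=2^{\{1,\ldots,n\}}\setminus\{\emptyset\}$ and, for $A\in\mathcal{A}$, $I_A(\mathbf{z})=\{(x,y,f)\in S: y f(t_i-x)=z_i,\ i\in A,\ y f(t_j-x)<z_j,\ j\notin A\}$. Define the random partition of $\Pi$ by $\Pi_1=\Pi\cap\overline{K_{\mathbf{t},Z(\mathbf{t})}}$, $\Pi_2=\Pi\cap K_{\mathbf{t},Z(\mathbf{t})}$, $\Pi_3=\Pi\setminus(\Pi_1\cup\Pi_2)$. $\mathcal{C}$ is the $\sigma$-algebra on $\mathbb{R}^{\mathbb{R}^d}$ generated by the cylinder sets $\{f\in\mathbb{R}^{\mathbb{R}^d}:(f(s_1),\ldots,f(s_m))\in B\}$ with $s_1,\ldots,s_m\in\mathbb{R}^d$, $B\in\mathcal{B}^m$, $m\in\mathbb{N}$. $|\cdot|$ denotes the number of points. A random set of points in $S$ is a point process if its numbers of points in bounded Borel sets are random variables. *)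

theory Defs
  imports "HOL-Probability.Probability"
begin

type_synonym 'd func = "real ^ 'd \<Rightarrow> real"
type_synonym 'd pt = "(real ^ 'd) \<times> real \<times> 'd func"

definition S_space :: "('d::finite) func set \<Rightarrow> 'd pt measure" where
  "S_space G = borel \<Otimes>\<^sub>M (restrict_space borel {0<..} \<Otimes>\<^sub>M count_space G)"

definition intensity :: "('d::finite) func measure \<Rightarrow> 'd pt measure" where
  "intensity P\<^sub>F =
     lborel \<Otimes>\<^sub>M (density (restrict_space lborel {0<..}) (\<lambda>u. ennreal (1 / u ^ 2)) \<Otimes>\<^sub>M P\<^sub>F)"

text \<open>
  No restriction is put on the third coordinate: \<open>G\<close> carries the discrete structure.
\<close>

definition bounded_Borel :: "('d::finite) func set \<Rightarrow> 'd pt set \<Rightarrow> bool" where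
  "bounded_Borel G B \<longleftrightarrow>
     B \<in> sets (S_space G) \<and> bounded (fst ` B) \<and> bounded ((fst \<circ> snd) ` B)"

text \<open>
  The number of points is extended-valued: the intensity has infinite mass on bounded
  sets that reach down to \<open>u = 0\<close>.
\<close>

definition num_points :: "'a set \<Rightarrow> ennreal" where
  "num_points X = emeasure (count_space UNIV) X"

text \<open>
  As usual, configurations are locally finite: there are finitely many points in each set
  that is bounded in the first coordinate and bounded away from \<open>0\<close> in the second one
  (the intensity is finite on these sets, which exhaust the space).
\<close>

definition point_process ::
    "('d::finite) func set \<Rightarrow> 'w measure \<Rightarrow> ('w \<Rightarrow> 'd pt set) \<Rightarrow> bool" where
  "point_process G M P \<longleftrightarrow>
     (\<forall>\<omega>\<in>space M. P \<omega> \<subseteq> space (S_space G)) \<and>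
     (\<forall>\<omega>\<in>space M. \<forall>r>0. finite {(x, u, f) \<in> P \<omega>. norm x \<le> r \<and> 1 / r \<le> u}) \<and>
     (\<forall>B. bounded_Borel G B \<longrightarrow> (\<lambda>\<omega>. num_points (P \<omega> \<inter> B)) \<in> borel_measurable M)"

definition Poisson_point_process ::
    "('d::finite) func set \<Rightarrow> 'd pt measure \<Rightarrow> 'w measure \<Rightarrow> ('w \<Rightarrow> 'd pt set) \<Rightarrow> bool" where
  "Poisson_point_process G \<Lambda> M P \<longleftrightarrow>
     point_process G M P \<and>
     (\<forall>B\<in>sets (S_space G). emeasure \<Lambda> B < \<infinity> \<longrightarrow>
        (\<forall>k::nat. measure M {\<omega>\<in>space M. num_points (P \<omega> \<inter> B) = of_nat k} =
           exp (- measure \<Lambda> B) * measure \<Lambda> B ^ k / fact k)) \<and>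
     (\<forall>B\<in>sets (S_space G). emeasure \<Lambda> B = \<infinity> \<longrightarrow>
        (AE \<omega> in M. num_points (P \<omega> \<inter> B) = \<infinity>)) \<and>
     (\<forall>(m::nat) B. (\<forall>i<m. B i \<in> sets (S_space G)) \<and> disjoint_family_on B {..<m} \<longrightarrow>
        prob_space.indep_vars M (\<lambda>_. borel) (\<lambda>i \<omega>. num_points (P \<omega> \<inter> B i)) {..<m})"

text \<open>
  The maximum over the points of a configuration is taken as a supremum in \<open>[0, \<infinity>]\<close>, so that
  it is defined for every configuration; accordingly the levels \<open>z\<close> below range over
  \<open>[0, \<infinity>]\<close>. In \<^typ>\<open>ennreal\<close>, \<open>z / 0 = \<infinity>\<close> for \<open>z > 0\<close>.
\<close>

definition Zmax :: "('d::finite) pt set \<Rightarrow> real ^ 'd \<Rightarrow> ennreal" where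
  "Zmax P t = (SUP (s, u, f)\<in>P. ennreal (u * f (t - s)))"

definition K_set ::
    "('d::finite) func set \<Rightarrow> nat \<Rightarrow> (nat \<Rightarrow> real ^ 'd) \<Rightarrow> (nat \<Rightarrow> ennreal) \<Rightarrow> 'd pt set" where
  "K_set G n t z = {(x, y, f) \<in> space (S_space G).
     ennreal y = (MIN i\<in>{1..n}. z i / ennreal (f (t i - x)))}"

definition K_upper ::
    "('d::finite) func set \<Rightarrow> nat \<Rightarrow> (nat \<Rightarrow> real ^ 'd) \<Rightarrow> (nat \<Rightarrow> ennreal) \<Rightarrow> 'd pt set" where
  "K_upper G n t z = {(x, y, f) \<in> space (S_space G).
     \<exists>j\<in>{1..n}. ennreal (y * f (t j - x)) > z j}"

definition I_set ::
    "('d::finite) func set \<Rightarrow> nat \<Rightarrow> (nat \<Rightarrow> real ^ 'd) \<Rightarrow> nat set \<Rightarrow> (nat \<Rightarrow> ennreal) \<Rightarrow> 'd pt set"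
  where
  "I_set G n t A z = {(x, y, f) \<in> space (S_space G).
     (\<forall>i\<in>A. ennreal (y * f (t i - x)) = z i) \<and>
     (\<forall>j\<in>{1..n} - A. ennreal (y * f (t j - x)) < z j)}"

definition Z_vec :: "(nat \<Rightarrow> real ^ 'd) \<Rightarrow> ('d::finite) pt set \<Rightarrow> nat \<Rightarrow> ennreal" where
  "Z_vec t P = (\<lambda>i. Zmax P (t i))"

definition part1 ::
    "('d::finite) func set \<Rightarrow> nat \<Rightarrow> (nat \<Rightarrow> real ^ 'd) \<Rightarrow> 'd pt set \<Rightarrow> 'd pt set" where
  "part1 G n t P = P \<inter> K_upper G n t (Z_vec t P)"

definition part2 ::
    "('d::finite) func set \<Rightarrow> nat \<Rightarrow> (nat \<Rightarrow> real ^ 'd) \<Rightarrow> 'd pt set \<Rightarrow> 'd pt set" where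
  "part2 G n t P = P \<inter> K_set G n t (Z_vec t P)"

definition part3 ::
    "('d::finite) func set \<Rightarrow> nat \<Rightarrow> (nat \<Rightarrow> real ^ 'd) \<Rightarrow> 'd pt set \<Rightarrow> 'd pt set" where
  "part3 G n t P = P - (part1 G n t P \<union> part2 G n t P)"

text \<open>
  Vectors in \<open>\<real>\<^sup>m\<close> are extensional functions on \<open>{..<m}\<close>, and the product measure space of
  \<open>m\<close> copies of \<^term>\<open>borel\<close> carries the Borel \<open>\<sigma>\<close>-algebra of \<open>\<real>\<^sup>m\<close>.
\<close>

definition cylinder_algebra :: "(real ^ 'd \<Rightarrow> real) measure" where
  "cylinder_algebra = sigma UNIV
     {{f. (\<lambda>i\<in>{..<m}. f (s i)) \<in> B} | (m::nat) (s :: nat \<Rightarrow> real ^ 'd) B.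
        B \<in> sets (Pi\<^sub>M {..<m} (\<lambda>_. borel :: real measure))}"

definition Psi :: "('d::finite) pt \<Rightarrow> real ^ 'd \<Rightarrow> real" where
  "Psi = (\<lambda>(x, y, f). (\<lambda>t. y * f (t - x)))"

end

theory Submission
  imports Defs
begin

text \<open>
  Everything rests on one fact: the number of points of \<open>P \<omega>\<close> in a random set \<open>{p. (\<omega>, p) \<in> H}\<close>
  is a random variable as soon as \<open>H\<close> is measurable in the product of the probability space and
  \<open>S\<close> (\<open>random_set_count_measurable\<close>). The sets \<open>H\<close> with this property include the measurable
  rectangles, because there the count is an indicator times the number of points in a fixed set.
  They are closed under countable disjoint unions. Closure under complements requires subtracting
  counts, hence finiteness; so the argument is carried out inside windows that are bounded and
  bounded away from \<open>u = 0\<close>, in which a configuration has finitely many points, and the windows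
  are then allowed to exhaust \<open>S\<close>.

  The sets \<open>I_set\<close>, \<open>K_set\<close> and \<open>K_upper\<close> at the levels \<open>Z(t)\<close> are random sets of this kind: they
  are given by finitely many comparisons between measurable functions of the point, namely
  \<open>(x, y, f) \<mapsto> y f(t_i - x)\<close>, \<open>(x, y, f) \<mapsto> f(t_i - x)\<close> and \<open>(x, y, f) \<mapsto> y\<close>, and the levels
  \<open>Z(t_i)\<close>. These functions are measurable because the third coordinate takes countably many
  values and each fixed \<open>f\<close> is measurable (\<open>measurable_shape_eval\<close>); this also yields the
  measurability of \<open>\<Psi>\<close>. The levels are random variables because \<open>Z(t_i) > a\<close> means that some
  point of \<open>P\<close> lies in the fixed measurable set \<open>{y f(t_i - x) > a}\<close> (\<open>Zmax_measurable\<close>). Local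
  finiteness of the three parts is inherited from \<open>P\<close>.
\<close>

section \<open>Measurability on the marked space\<close>

lemma measurable_if_eq_on_space:
  assumes "g \<in> measurable M N" and "\<And>\<omega>. \<omega> \<in> space M \<Longrightarrow> f \<omega> = g \<omega>"
  shows "f \<in> measurable M N"
  using assms(1) measurable_cong[of M f g N] assms(2) by blast

lemma space_S_space: "space (S_space G) = UNIV \<times> ({0<..} \<times> G)"
  by (simp add: S_space_def space_pair_measure space_restrict_space)

lemma measurable_location [measurable]:
  "fst \<in> measurable (S_space (G :: ('d::finite) func set)) borel"
  by (simp add: S_space_def)

lemma measurable_height [measurable]:
  "(\<lambda>p. fst (snd p)) \<in> measurable (S_space (G :: ('d::finite) func set)) borel"
proof -
  have "fst \<circ> snd \<in> measurable (S_space G) (restrict_space borel {0::real<..})"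
    unfolding S_space_def by (intro measurable_comp[OF measurable_snd measurable_fst])
  then show ?thesis
    by (auto simp: comp_def measurable_restrict_space2_iff)
qed

lemma measurable_shape:
  "(\<lambda>p. snd (snd p)) \<in> measurable (S_space (G :: ('d::finite) func set)) (count_space G)"
proof -
  have "snd \<circ> snd \<in> measurable (S_space G) (count_space G)"
    unfolding S_space_def by (intro measurable_comp[OF measurable_snd measurable_snd])
  then show ?thesis by (simp add: comp_def)
qed

text \<open>
  Evaluation \<open>(f, x) \<mapsto> f x\<close> is not jointly measurable for a general family of functions; it is
  here because \<open>S\<close> splits into countably many measurable pieces on which \<open>f\<close> is constant.
\<close>

lemma measurable_shape_eval:
  fixes G :: "('d::finite) func set"
  assumes "countable G" and "\<And>f. f \<in> G \<Longrightarrow> f \<in> borel_measurable borel"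
  shows "(\<lambda>p. snd (snd p) (s - fst p)) \<in> borel_measurable (S_space G)"
proof (rule measurable_compose_countable'[OF _ measurable_shape assms(1)])
  fix f assume "f \<in> G"
  then have [measurable]: "f \<in> borel_measurable borel" by (rule assms(2))
  show "(\<lambda>p. f (s - fst p)) \<in> borel_measurable (S_space G)" by measurable
qed

lemma Psi_measurable:
  fixes G :: "('d::finite) func set"
  assumes "countable G" and "\<And>f. f \<in> G \<Longrightarrow> f \<in> borel_measurable borel"
  shows "Psi \<in> measurable (S_space G) cylinder_algebra"
  unfolding cylinder_algebra_def
proof (rule measurable_measure_of, goal_cases)
  case (3 C)
  then obtain m :: nat and s :: "nat \<Rightarrow> real ^ 'd" and B
    where C: "C = {f. (\<lambda>i\<in>{..<m}. f (s i)) \<in> B}"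
      and B: "B \<in> sets (Pi\<^sub>M {..<m} (\<lambda>_. borel :: real measure))"
    by blast
  note [measurable] = measurable_shape_eval[OF assms]
  have "(\<lambda>p. \<lambda>i\<in>{..<m}. Psi p (s i)) \<in> measurable (S_space G) (Pi\<^sub>M {..<m} (\<lambda>_. borel))"
    by (rule measurable_restrict) (simp add: Psi_def case_prod_beta)
  from measurable_sets[OF this B] show ?case
    by (simp add: C vimage_def)
qed auto

section \<open>Counting points in random sets\<close>

text \<open>
  Windows are bounded, so that counts in them are random variables by definition, and bounded
  away from \<open>u = 0\<close>, so that these counts are finite.
\<close>

definition window :: "('d::finite) func set \<Rightarrow> nat \<Rightarrow> 'd pt set" where
  "window G k = {p \<in> space (S_space G). norm (fst p) \<le> real (Suc k) \<and>
     1 / real (Suc k) \<le> fst (snd p) \<and> fst (snd p) \<le> real (Suc k)}"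

lemma window_sets [measurable]: "window G k \<in> sets (S_space G)"
  unfolding window_def by measurable

lemma incseq_window: "incseq (window G)"
proof (rule incseq_SucI)
  fix k
  have "1 / real (Suc (Suc k)) \<le> 1 / real (Suc k)" by (simp add: frac_le)
  then show "window G k \<subseteq> window G (Suc k)" by (auto simp: window_def)
qed

lemma UN_window: "(\<Union>k. window G k) = space (S_space G)"
proof -
  have "\<exists>k. p \<in> window G k" if p: "p \<in> space (S_space G)" for p
  proof -
    have pos: "0 < fst (snd p)" using p by (auto simp: space_S_space)
    obtain k where k: "norm (fst p) + fst (snd p) + 1 / fst (snd p) < real k"
      using reals_Archimedean2 by blast
    have "0 < 1 / fst (snd p)" using pos by simp
    with k pos norm_ge_zero[of "fst p"]
    have *: "norm (fst p) \<le> real (Suc k)" "fst (snd p) \<le> real (Suc k)"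
      "1 / fst (snd p) \<le> real (Suc k)" by linarith+
    have "1 / real (Suc k) \<le> fst (snd p)"
      using *(3) pos by (simp add: field_simps)
    with * p show ?thesis by (auto simp: window_def)
  qed
  then show ?thesis by (auto simp: window_def)
qed

lemma bounded_Borel_Int_window:
  assumes "B \<in> sets (S_space G)"
  shows "bounded_Borel G (B \<inter> window G k)"
  unfolding bounded_Borel_def
proof (intro conjI)
  show "B \<inter> window G k \<in> sets (S_space G)" using assms by measurable
  show "bounded (fst ` (B \<inter> window G k))"
    by (rule boundedI[of _ "real (Suc k)"]) (auto simp: window_def)
  show "bounded ((fst \<circ> snd) ` (B \<inter> window G k))"
    by (rule boundedI[of _ "real (Suc k)"]) (auto simp: window_def space_S_space)
qed

lemma finite_Int_window:
  assumes "point_process G M P" "\<omega> \<in> space M"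
  shows "finite (P \<omega> \<inter> window G k)"
proof (rule finite_subset)
  show "finite {(x, u, f) \<in> P \<omega>. norm x \<le> real (Suc k) \<and> 1 / real (Suc k) \<le> u}"
    using assms by (simp add: point_process_def del: of_nat_Suc)
  show "P \<omega> \<inter> window G k \<subseteq> {(x, u, f) \<in> P \<omega>. norm x \<le> real (Suc k) \<and> 1 / real (Suc k) \<le> u}"
    by (auto simp: window_def)
qed

lemma num_points_incseq:
  assumes "incseq A"
  shows "num_points (\<Union>k. A k) = (SUP k. num_points (A k))"
  unfolding num_points_def using assms by (intro SUP_emeasure_incseq[symmetric]) auto

text \<open>
  The rectangles form an intersection-stable generator, so Dynkin's lemma applies: the class of
  good sets \<open>H\<close> is closed under disjoint unions by additivity of the count, and under complements
  because counts within a window are finite and may be subtracted.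
\<close>

lemma random_set_count_window_measurable:
  fixes G :: "('d::finite) func set"
  assumes P: "point_process G M P" and H: "H \<in> sets (M \<Otimes>\<^sub>M S_space G)"
  shows "(\<lambda>\<omega>. num_points (P \<omega> \<inter> window G k \<inter> {p. (\<omega>, p) \<in> H})) \<in> borel_measurable M"
proof -
  let ?N = "\<lambda>H \<omega>. num_points (P \<omega> \<inter> window G k \<inter> {p. (\<omega>, p) \<in> H})"
  have count: "(\<lambda>\<omega>. num_points (P \<omega> \<inter> window G k \<inter> B)) \<in> borel_measurable M"
    if "B \<in> sets (S_space G)" for B
  proof -
    have "(\<lambda>\<omega>. num_points (P \<omega> \<inter> (B \<inter> window G k))) \<in> borel_measurable M"
      using P bounded_Borel_Int_window[OF that, of k] unfolding point_process_def by blast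
    moreover have "P \<omega> \<inter> (B \<inter> window G k) = P \<omega> \<inter> window G k \<inter> B" for \<omega> by blast
    ultimately show ?thesis by simp
  qed
  have H': "H \<in> sigma_sets (space M \<times> space (S_space G))
      {A \<times> B | A B. A \<in> sets M \<and> B \<in> sets (S_space G)}"
    using H by (simp add: sets_pair_measure)
  have "Int_stable {A \<times> B | A B. A \<in> sets M \<and> B \<in> sets (S_space G)}"
    by (rule Int_stable_pair_measure_generator)
  moreover have "{A \<times> B | A B. A \<in> sets M \<and> B \<in> sets (S_space G)}
      \<subseteq> Pow (space M \<times> space (S_space G))"
    by (rule pair_measure_closed)
  ultimately show ?thesis using H'
  proof (induction rule: sigma_sets_induct_disjoint)
    case (basic R)
    then obtain A B where R: "R = A \<times> B" and A: "A \<in> sets M" and B: "B \<in> sets (S_space G)"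
      by blast
    have "?N R = (\<lambda>\<omega>. indicator A \<omega> * num_points (P \<omega> \<inter> window G k \<inter> B))"
      by (auto simp: R num_points_def indicator_def)
    also have "\<dots> \<in> borel_measurable M"
      using A count[OF B] by measurable
    finally show ?case .
  next
    case empty
    show ?case by simp
  next
    case (compl R)
    have diff: "?N (space M \<times> space (S_space G) - R) \<omega>
        = num_points (P \<omega> \<inter> window G k \<inter> space (S_space G)) - ?N R \<omega>" if \<omega>: "\<omega> \<in> space M" for \<omega>
    proof -
      have split: "P \<omega> \<inter> window G k \<inter> {p. (\<omega>, p) \<in> space M \<times> space (S_space G) - R}
          = P \<omega> \<inter> window G k \<inter> space (S_space G) - P \<omega> \<inter> window G k \<inter> {p. (\<omega>, p) \<in> R}"
        using \<omega> by auto
      have fin: "finite (P \<omega> \<inter> window G k \<inter> {p. (\<omega>, p) \<in> R})"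
        using finite_Int_window[OF P \<omega>, of k] by simp
      show ?thesis
        unfolding split num_points_def
        using fin by (intro emeasure_Diff) (auto simp: window_def)
    qed
    have "(\<lambda>\<omega>. num_points (P \<omega> \<inter> window G k \<inter> space (S_space G)) - ?N R \<omega>)
        \<in> borel_measurable M"
      using count[OF sets.top] compl.IH by measurable
    then show ?case
      by (rule measurable_if_eq_on_space) (rule diff)
  next
    case (union R)
    have "?N (\<Union>i. R i) \<omega> = (\<Sum>i. ?N (R i) \<omega>)" for \<omega>
    proof -
      have split: "P \<omega> \<inter> window G k \<inter> {p. (\<omega>, p) \<in> (\<Union>i. R i)}
          = (\<Union>i. P \<omega> \<inter> window G k \<inter> {p. (\<omega>, p) \<in> R i})"
        by auto
      show ?thesis
        unfolding split num_points_def using union.hyps(1)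
        by (intro suminf_emeasure[symmetric]) (auto simp: disjoint_family_on_def)
    qed
    moreover have "(\<lambda>\<omega>. \<Sum>i. ?N (R i) \<omega>) \<in> borel_measurable M"
      using union.IH by measurable
    ultimately show ?case by simp
  qed
qed

text \<open>
  Since the windows increase to \<open>S\<close>, the full count is the supremum of the counts within windows.
\<close>

lemma random_set_count_measurable:
  fixes G :: "('d::finite) func set"
  assumes P: "point_process G M P" and H: "H \<in> sets (M \<Otimes>\<^sub>M S_space G)"
  shows "(\<lambda>\<omega>. num_points (P \<omega> \<inter> {p. (\<omega>, p) \<in> H})) \<in> borel_measurable M"
proof -
  have exhaust: "num_points (P \<omega> \<inter> {p. (\<omega>, p) \<in> H})
      = (SUP k. num_points (P \<omega> \<inter> window G k \<inter> {p. (\<omega>, p) \<in> H}))" if "\<omega> \<in> space M" for \<omega>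
  proof -
    have "P \<omega> \<subseteq> space (S_space G)"
      using P that by (simp add: point_process_def)
    then have "P \<omega> \<inter> {p. (\<omega>, p) \<in> H} = P \<omega> \<inter> (\<Union>k. window G k) \<inter> {p. (\<omega>, p) \<in> H}"
      by (simp add: UN_window Int_absorb2)
    also have "\<dots> = (\<Union>k. P \<omega> \<inter> window G k \<inter> {p. (\<omega>, p) \<in> H})"
      by auto
    finally have eq: "P \<omega> \<inter> {p. (\<omega>, p) \<in> H} = (\<Union>k. P \<omega> \<inter> window G k \<inter> {p. (\<omega>, p) \<in> H})" .
    have mono: "incseq (\<lambda>k. P \<omega> \<inter> window G k \<inter> {p. (\<omega>, p) \<in> H})"
    proof (rule incseq_SucI)
      fix k
      have "window G k \<subseteq> window G (Suc k)" by (rule incseq_SucD[OF incseq_window])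
      then show "P \<omega> \<inter> window G k \<inter> {p. (\<omega>, p) \<in> H}
          \<subseteq> P \<omega> \<inter> window G (Suc k) \<inter> {p. (\<omega>, p) \<in> H}" by auto
    qed
    show ?thesis using num_points_incseq[OF mono] by (simp only: eq)
  qed
  have "(\<lambda>\<omega>. SUP k. num_points (P \<omega> \<inter> window G k \<inter> {p. (\<omega>, p) \<in> H}))
      \<in> borel_measurable M"
  proof (rule borel_measurable_SUP)
    show "countable (UNIV :: nat set)" by simp
    show "(\<lambda>\<omega>. num_points (P \<omega> \<inter> window G k \<inter> {p. (\<omega>, p) \<in> H})) \<in> borel_measurable M" for k
      using assms by (rule random_set_count_window_measurable)
  qed
  then show ?thesis
    by (rule measurable_if_eq_on_space) (rule exhaust)
qed

lemma point_process_count_measurable: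
  fixes G :: "('d::finite) func set"
  assumes P: "point_process G M P" and B: "B \<in> sets (S_space G)"
  shows "(\<lambda>\<omega>. num_points (P \<omega> \<inter> B)) \<in> borel_measurable M"
proof -
  have "space M \<times> B \<in> sets (M \<Otimes>\<^sub>M S_space G)" using B by measurable
  from random_set_count_measurable[OF P this]
  show ?thesis
  proof (rule measurable_if_eq_on_space)
    fix \<omega> assume "\<omega> \<in> space M"
    then have "P \<omega> \<inter> B = P \<omega> \<inter> {p. (\<omega>, p) \<in> space M \<times> B}" by auto
    then show "num_points (P \<omega> \<inter> B) = num_points (P \<omega> \<inter> {p. (\<omega>, p) \<in> space M \<times> B})"
      by (rule arg_cong)
  qed
qed

text \<open>
  The counts of the thinned process in \<open>B\<close> are counts of \<open>P\<close> in the random set cut down to \<open>B\<close>, and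
  a subset of a locally finite configuration is locally finite.
\<close>

lemma point_process_thinning:
  fixes G :: "('d::finite) func set"
  assumes P: "point_process G M P"
    and H: "Measurable.pred (M \<Otimes>\<^sub>M S_space G) (\<lambda>(\<omega>, p). H \<omega> p)"
    and Q: "\<And>\<omega>. \<omega> \<in> space M \<Longrightarrow> Q \<omega> = {p \<in> P \<omega>. H \<omega> p}"
  shows "point_process G M Q"
  unfolding point_process_def
proof (intro conjI allI impI ballI)
  fix \<omega> assume \<omega>: "\<omega> \<in> space M"
  show "Q \<omega> \<subseteq> space (S_space G)"
    using P \<omega> Q[OF \<omega>] unfolding point_process_def by blast
  fix r :: real assume "0 < r"
  then have "finite {(x, u, f) \<in> P \<omega>. norm x \<le> r \<and> 1 / r \<le> u}"
    using P \<omega> unfolding point_process_def by blast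
  then show "finite {(x, u, f) \<in> Q \<omega>. norm x \<le> r \<and> 1 / r \<le> u}"
    by (rule rev_finite_subset) (auto simp: Q[OF \<omega>])
next
  fix B assume "bounded_Borel G B"
  then have [measurable]: "B \<in> sets (S_space G)" by (simp add: bounded_Borel_def)
  note H [measurable]
  let ?H = "{q \<in> space (M \<Otimes>\<^sub>M S_space G). (case q of (\<omega>, p) \<Rightarrow> H \<omega> p) \<and> snd q \<in> B}"
  have "?H \<in> sets (M \<Otimes>\<^sub>M S_space G)" by measurable
  from random_set_count_measurable[OF P this]
  show "(\<lambda>\<omega>. num_points (Q \<omega> \<inter> B)) \<in> borel_measurable M"
  proof (rule measurable_if_eq_on_space)
    fix \<omega> assume \<omega>: "\<omega> \<in> space M"
    then have "P \<omega> \<subseteq> space (S_space G)"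
      using P by (simp add: point_process_def)
    then have "Q \<omega> \<inter> B = P \<omega> \<inter> {p. (\<omega>, p) \<in> ?H}"
      using \<omega> by (auto simp: Q space_pair_measure)
    then show "num_points (Q \<omega> \<inter> B) = num_points (P \<omega> \<inter> {p. (\<omega>, p) \<in> ?H})"
      by (rule arg_cong)
  qed
qed

section \<open>The random levels and the random partition\<close>

text \<open>
  The supremum exceeds \<open>a\<close> exactly if \<open>P\<close> has a point in a certain measurable set. This set may be
  unbounded, so the measurability of counts is needed beyond bounded Borel sets.
\<close>

lemma Zmax_measurable:
  fixes G :: "('d::finite) func set"
  assumes G: "countable G" "\<And>f. f \<in> G \<Longrightarrow> f \<in> borel_measurable borel"
    and P: "point_process G M P"
  shows "(\<lambda>\<omega>. Zmax (P \<omega>) s) \<in> borel_measurable M"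
proof (rule borel_measurableI_greater)
  fix a :: ennreal
  note [measurable] = measurable_shape_eval[OF G]
  let ?B = "{p \<in> space (S_space G). a < ennreal (fst (snd p) * snd (snd p) (s - fst p))}"
  have "?B \<in> sets (S_space G)" by measurable
  note [measurable] = point_process_count_measurable[OF P this]
  have "a < Zmax (P \<omega>) s \<longleftrightarrow> num_points (P \<omega> \<inter> ?B) \<noteq> 0" if "\<omega> \<in> space M" for \<omega>
  proof -
    have "P \<omega> \<subseteq> space (S_space G)"
      using P that by (simp add: point_process_def)
    then have "(\<exists>p\<in>P \<omega>. a < ennreal (fst (snd p) * snd (snd p) (s - fst p)))
        \<longleftrightarrow> P \<omega> \<inter> ?B \<noteq> {}"
      by blast
    then have "a < Zmax (P \<omega>) s \<longleftrightarrow> P \<omega> \<inter> ?B \<noteq> {}"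
      unfolding Zmax_def case_prod_beta less_SUP_iff .
    then show ?thesis
      by (simp add: num_points_def emeasure_count_space_eq_0)
  qed
  then have "{\<omega> \<in> space M. a < Zmax (P \<omega>) s} = {\<omega> \<in> space M. num_points (P \<omega> \<inter> ?B) \<noteq> 0}"
    by blast
  also have "\<dots> \<in> sets M" by measurable
  finally show "{\<omega> \<in> space M. a < Zmax (P \<omega>) s} \<in> sets M" .
qed

theorem proposition1:
  fixes G :: "(real ^ 'd::finite \<Rightarrow> real) set"
    and N :: "'v measure" and F :: "'v \<Rightarrow> real ^ 'd \<Rightarrow> real"
    and M :: "'w measure" and P :: "'w \<Rightarrow> ((real ^ 'd) \<times> real \<times> (real ^ 'd \<Rightarrow> real)) set"
    and n :: nat and t :: "nat \<Rightarrow> real ^ 'd"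
  assumes "countable G"
    and "\<And>f. f \<in> G \<Longrightarrow> f \<in> borel_measurable borel"
    and "\<And>f x. f \<in> G \<Longrightarrow> 0 \<le> f x"
    and "prob_space N"
    and "F \<in> measurable N (count_space G)"
    and "(\<integral>\<^sup>+ w. (\<integral>\<^sup>+ x. ennreal (F w x) \<partial>lborel) \<partial>N) = 1"
    and "prob_space M"
    and "Poisson_point_process G (intensity (distr N (count_space G) F)) M P"
    and "1 \<le> n"
  shows "Psi \<in> measurable (S_space G) cylinder_algebra \<and>
    (\<forall>A B. A \<subseteq> {1..n} \<and> A \<noteq> {} \<and> bounded_Borel G B \<longrightarrow>
      (\<lambda>\<omega>. num_points (P \<omega> \<inter> I_set G n t A (Z_vec t (P \<omega>)) \<inter> B)) \<in> borel_measurable M) \<and>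
    point_process G M (\<lambda>\<omega>. part1 G n t (P \<omega>)) \<and>
    point_process G M (\<lambda>\<omega>. part2 G n t (P \<omega>)) \<and>
    point_process G M (\<lambda>\<omega>. part3 G n t (P \<omega>))"
proof -
  note G = assms(1,2)
  have P: "point_process G M P"
    using assms(8) by (simp add: Poisson_point_process_def)
  note [measurable] = measurable_shape_eval[OF G]
  have [measurable]: "(\<lambda>\<omega>. Z_vec t (P \<omega>) i) \<in> borel_measurable M" for i
    using Zmax_measurable[OF G P] by (simp add: Z_vec_def)
  have in_S: "p \<in> space (S_space G)" if "p \<in> P \<omega>" "\<omega> \<in> space M" for p \<omega>
    using P that unfolding point_process_def by blast

  let ?v = "\<lambda>i p. ennreal (fst (snd p) * snd (snd p) (t i - fst p))"
  let ?upper = "\<lambda>\<omega> p. \<exists>j\<in>{1..n}. Z_vec t (P \<omega>) j < ?v j p"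
  let ?K = "\<lambda>\<omega> p. ennreal (fst (snd p))
    = (MIN i\<in>{1..n}. Z_vec t (P \<omega>) i / ennreal (snd (snd p) (t i - fst p)))"
  let ?I = "\<lambda>A \<omega> p. (\<forall>i\<in>A. ?v i p = Z_vec t (P \<omega>) i) \<and> (\<forall>j\<in>{1..n} - A. ?v j p < Z_vec t (P \<omega>) j)"

  have upper [measurable]: "Measurable.pred (M \<Otimes>\<^sub>M S_space G) (\<lambda>(\<omega>, p). ?upper \<omega> p)"
    by measurable
  have min [measurable]: "(\<lambda>(\<omega>, p). MIN i\<in>{1..n}. Z_vec t (P \<omega>) i / ennreal (snd (snd p) (t i - fst p)))
      \<in> borel_measurable (M \<Otimes>\<^sub>M S_space G)"
    unfolding case_prod_beta by (rule borel_measurable_Min) measurable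
  have K [measurable]: "Measurable.pred (M \<Otimes>\<^sub>M S_space G) (\<lambda>(\<omega>, p). ?K \<omega> p)"
    using min unfolding case_prod_beta by measurable

  have "point_process G M (\<lambda>\<omega>. P \<omega> \<inter> I_set G n t A (Z_vec t (P \<omega>)))" if "A \<subseteq> {1..n}" for A
  proof (rule point_process_thinning[OF P, where H = "?I A"])
    have [simp]: "finite A" using that finite_subset by blast
    have [measurable]: "countable A" "countable ({1..n} - A)" by (auto simp: countable_finite)
    show "Measurable.pred (M \<Otimes>\<^sub>M S_space G) (\<lambda>(\<omega>, p). ?I A \<omega> p)"
      by measurable
  qed (auto simp: I_set_def dest: in_S)
  then have "(\<lambda>\<omega>. num_points (P \<omega> \<inter> I_set G n t A (Z_vec t (P \<omega>)) \<inter> B)) \<in> borel_measurable M"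
    if "A \<subseteq> {1..n}" "bounded_Borel G B" for A B
    using that unfolding point_process_def by blast
  moreover have "point_process G M (\<lambda>\<omega>. part1 G n t (P \<omega>))"
    by (rule point_process_thinning[OF P upper]) (auto simp: part1_def K_upper_def dest: in_S)
  moreover have "point_process G M (\<lambda>\<omega>. part2 G n t (P \<omega>))"
    by (rule point_process_thinning[OF P K]) (auto simp: part2_def K_set_def dest: in_S)
  moreover have "point_process G M (\<lambda>\<omega>. part3 G n t (P \<omega>))"
  proof (rule point_process_thinning[OF P, where H = "\<lambda>\<omega> p. \<not> ?upper \<omega> p \<and> \<not> ?K \<omega> p"])
    show "Measurable.pred (M \<Otimes>\<^sub>M S_space G) (\<lambda>(\<omega>, p). \<not> ?upper \<omega> p \<and> \<not> ?K \<omega> p)"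
      using upper K unfolding case_prod_beta by measurable
  qed (auto simp: part1_def part2_def part3_def K_upper_def K_set_def dest: in_S)
  ultimately show ?thesis
    using Psi_measurable[OF G] by blast
qed

end
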